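(* Let $K$ be a field of arbitrary characteristic. The endomorphism \[ \tau=(x+x^2[y,z],\,y,\,z) \] of the free metabelian algebra $M(x,y,z)$ over $K$ is a wild automorphism which cannot be lifted to an automorphism of $K\langle x,y,z\rangle$. Its Jacobian matrix \[ J_M(\tau)=\begin{pmatrix} 1&0&0\\ x_1^2(z_2-z_1)&1&0\\ x_1^2(y_1-y_2)&0&1 \end{pmatrix} \] is a product of two elementary matrices (with entries from $K[x_1,y_1,z_1,x_2,y_2,z_2]$).
   Context: $K\langle x,y,z\rangle$ is the free unital associative algebra, $[a,b]=ab-ba$, and $M(x,y,z)$ is the free metabelian associative algebra of rank $3$: the quotient of $K\langle x,y,z\rangle$ by the two-sided ideal generated by all products $[a,b][c,d]$, $a,b,c,d\in K\langle x,y,z\rangle$. Endomorphisms are written as triples of the images of $x,y,z$. An automorphism of $M(x,y,z)$ is elementary if it sends one generator $t\in\{x,y,z\}$ to $\alpha t+p$, with $\alpha\in K^{\ast}$ and $p$ a polynomial in the other two generators only, and fixes the other two; it is tame if it lies in the group generated by elementary automorphisms, and wild otherwise. An automorphism $\tau$ of $M(x,y,z)$ can be lifted to an automorphism of $K\langle x,y,z\rangle$ if there is an automorphism $\sigma$ of $K\langle x,y,z\rangle$ which induces $\tau$ via the natural homomorphism $K\langle x,y,z\rangle\to M(x,y,z)$. Partial derivatives: let $K[x_1,y_1,z_1,x_2,y_2,z_2]$ be the commutative polynomial algebra. For $t\in\{x,y,z\}$, let $\partial_M/\partial_M t: M(x,y,z)\to K[x_1,y_1,z_1,x_2,y_2,z_2]$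 be the ($K$-linear, well defined) map which sends a monomial $w=t_1t_2\cdots t_m$ ($t_k\in\{x,y,z\}$) to $\sum_{k:\,t_k=t}(t_1)_1\cdots(t_{k-1})_1\,(t_{k+1})_2\cdots(t_m)_2$, where $(x)_i=x_i$, $(y)_i=y_i$, $(z)_i=z_i$ for $i=1,2$ (and constants are sent to $0$). The Jacobian matrix $J_M(\varphi)$ of $\varphi=(f,g,h)$ is the $3\times 3$ matrix whose columns are the vectors $(\partial_M/\partial_M x,\partial_M/\partial_M y,\partial_M/\partial_M z)^{T}$ applied to $f,g,h$ respectively. An elementary matrix is one differing from the identity matrix in at most one off-diagonal entry. *)

theory Defs
  imports "HOL-Analysis.Analysis" "HOL-Library.Poly_Mapping"
begin

section \<open>The free associative algebra on three generators\<close>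

datatype gen = X | Y | Z

text \<open>
  Words form the free monoid, written additively (addition is concatenation) because
  multiplication of \<^typ>\<open>'a \<Rightarrow>\<^sub>0 'b\<close> is convolution over an additive monoid of keys.  With this
  instance \<^typ>\<open>gen list \<Rightarrow>\<^sub>0 'k\<close> is the monoid algebra of the free monoid, that is, the free
  associative algebra.
\<close>

instantiation list :: (type) monoid_add
begin

definition zero_list :: "'a list" where "zero_list = []"

definition plus_list :: "'a list \<Rightarrow> 'a list \<Rightarrow> 'a list" where "plus_list u v = u @ v"

instance
  by standard (simp_all add: zero_list_def plus_list_def)

end

type_synonym 'k free_alg = "gen list \<Rightarrow>\<^sub>0 'k"

definition free_const :: "'k::field \<Rightarrow> 'k free_alg" where
  "free_const c = Poly_Mapping.single [] c"

definition free_gen :: "gen \<Rightarrow> 'k::field free_alg" where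
  "free_gen t = Poly_Mapping.single [t] 1"

text \<open>
  Evaluation of noncommutative polynomials at \<open>g\<close> in a \<open>K\<close>-algebra, the latter being given as a ring
  together with its structure map \<open>\<kappa>\<close> from \<open>K\<close> to the centre.
\<close>

definition free_eval :: "('k::field \<Rightarrow> 'b::ring_1) \<Rightarrow> (gen \<Rightarrow> 'b) \<Rightarrow> 'k free_alg \<Rightarrow> 'b" where
  "free_eval \<kappa> g p =
     (\<Sum>w\<in>Poly_Mapping.keys p. \<kappa> (Poly_Mapping.lookup p w) * prod_list (map g w))"

definition structure_map :: "('k::field \<Rightarrow> 'b::ring_1) \<Rightarrow> bool" where
  "structure_map \<kappa> \<longleftrightarrow>
     \<kappa> 1 = 1 \<and> (\<forall>a b. \<kappa> (a + b) = \<kappa> a + \<kappa> b) \<and> (\<forall>a b. \<kappa> (a * b) = \<kappa> a * \<kappa> b) \<and>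
     (\<forall>a x. \<kappa> a * x = x * \<kappa> a)"

definition alg_endo :: "('k::field \<Rightarrow> 'b::ring_1) \<Rightarrow> ('b \<Rightarrow> 'b) \<Rightarrow> bool" where
  "alg_endo \<kappa> \<phi> \<longleftrightarrow>
     \<phi> 1 = 1 \<and> (\<forall>a b. \<phi> (a + b) = \<phi> a + \<phi> b) \<and> (\<forall>a b. \<phi> (a * b) = \<phi> a * \<phi> b) \<and>
     (\<forall>c. \<phi> (\<kappa> c) = \<kappa> c)"

definition alg_aut :: "('k::field \<Rightarrow> 'b::ring_1) \<Rightarrow> ('b \<Rightarrow> 'b) \<Rightarrow> bool" where
  "alg_aut \<kappa> \<phi> \<longleftrightarrow> alg_endo \<kappa> \<phi> \<and> bij \<phi>"

definition commutator :: "'a::ring_1 \<Rightarrow> 'a \<Rightarrow> 'a" where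
  "commutator a b = a * b - b * a"


section \<open>The free metabelian algebra\<close>

inductive_set two_sided_ideal :: "'a::ring_1 set \<Rightarrow> 'a set" for S where
  zero: "0 \<in> two_sided_ideal S"
| base: "s \<in> S \<Longrightarrow> s \<in> two_sided_ideal S"
| add: "p \<in> two_sided_ideal S \<Longrightarrow> q \<in> two_sided_ideal S \<Longrightarrow> p + q \<in> two_sided_ideal S"
| lmult: "p \<in> two_sided_ideal S \<Longrightarrow> a * p \<in> two_sided_ideal S"
| rmult: "p \<in> two_sided_ideal S \<Longrightarrow> p * a \<in> two_sided_ideal S"

definition metab_ideal :: "'k::field free_alg set" where
  "metab_ideal = two_sided_ideal {commutator a b * commutator c d | a b c d. True}"

lemma ideal_uminus: "p \<in> two_sided_ideal S \<Longrightarrow> - p \<in> two_sided_ideal S"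
  using two_sided_ideal.lmult[of p S "- 1"] by simp

lemma ideal_diff:
  "p \<in> two_sided_ideal S \<Longrightarrow> q \<in> two_sided_ideal S \<Longrightarrow> p - q \<in> two_sided_ideal S"
  using two_sided_ideal.add[of p S "- q"] ideal_uminus[of q S] by simp

definition metab_rel :: "'k::field free_alg \<Rightarrow> 'k free_alg \<Rightarrow> bool" where
  "metab_rel p q \<longleftrightarrow> p - q \<in> metab_ideal"

lemma equivp_metab_rel: "equivp (metab_rel :: 'k::field free_alg \<Rightarrow> _)"
proof (rule equivpI)
  show "reflp (metab_rel :: 'k free_alg \<Rightarrow> _)"
    by (simp add: reflp_def metab_rel_def metab_ideal_def two_sided_ideal.zero)
  show "symp (metab_rel :: 'k free_alg \<Rightarrow> _)"
    unfolding metab_rel_def metab_ideal_def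
    by (rule sympI, subst minus_diff_eq[symmetric], rule ideal_uminus)
  show "transp (metab_rel :: 'k free_alg \<Rightarrow> _)"
  proof (rule transpI)
    fix p q r :: "'k free_alg"
    assume "metab_rel p q" "metab_rel q r"
    then have "(p - q) + (q - r) \<in> metab_ideal"
      unfolding metab_rel_def metab_ideal_def by (rule two_sided_ideal.add)
    then show "metab_rel p r" by (simp add: metab_rel_def)
  qed
qed

lemma
  assumes "structure_map \<kappa>"
  shows structure_map_one: "\<kappa> 1 = 1"
    and structure_map_add: "\<kappa> (a + b) = \<kappa> a + \<kappa> b"
    and structure_map_mult: "\<kappa> (a * b) = \<kappa> a * \<kappa> b"
    and structure_map_central: "\<kappa> a * x = x * \<kappa> a"
  using assms unfolding structure_map_def by blast+

lemma structure_map_zero: "structure_map \<kappa> \<Longrightarrow> \<kappa> 0 = 0"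
  using structure_map_add[of \<kappa> 0 0] by simp

text \<open>Linear extension of a function on words.\<close>

definition lin_ext :: "('k::field \<Rightarrow> 'b::ring_1) \<Rightarrow> (gen list \<Rightarrow> 'b) \<Rightarrow> 'k free_alg \<Rightarrow> 'b" where
  "lin_ext \<kappa> D p = (\<Sum>w\<in>Poly_Mapping.keys p. \<kappa> (Poly_Mapping.lookup p w) * D w)"

lemma lin_ext_superset:
  assumes "structure_map \<kappa>" "finite A" "Poly_Mapping.keys p \<subseteq> A"
  shows "lin_ext \<kappa> D p = (\<Sum>w\<in>A. \<kappa> (Poly_Mapping.lookup p w) * D w)"
  unfolding lin_ext_def using assms structure_map_zero[OF assms(1)]
  by (intro sum.mono_neutral_left) (auto simp: in_keys_iff)

lemma lin_ext_add:
  assumes "structure_map \<kappa>"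
  shows "lin_ext \<kappa> D (p + q) = lin_ext \<kappa> D p + lin_ext \<kappa> D q"
proof -
  let ?A = "Poly_Mapping.keys p \<union> Poly_Mapping.keys q"
  have "lin_ext \<kappa> D r = (\<Sum>w\<in>?A. \<kappa> (Poly_Mapping.lookup r w) * D w)"
    if "Poly_Mapping.keys r \<subseteq> ?A" for r
    using that by (intro lin_ext_superset assms) auto
  moreover have "Poly_Mapping.keys (p + q) \<subseteq> ?A" by (rule Poly_Mapping.keys_add)
  ultimately show ?thesis
    using assms by (simp add: lookup_add structure_map_add distrib_right sum.distrib)
qed

lemma lin_ext_single:
  assumes "structure_map \<kappa>"
  shows "lin_ext \<kappa> D (Poly_Mapping.single w c) = \<kappa> c * D w"
  using structure_map_zero[OF assms] by (auto simp: lin_ext_def)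

lemma lin_ext_zero [simp]: "lin_ext \<kappa> D 0 = 0"
  by (simp add: lin_ext_def)

lemma free_alg_induct [case_names zero add]:
  fixes p :: "'k::field free_alg"
  assumes "P 0" and "\<And>w c q. P q \<Longrightarrow> P (Poly_Mapping.single w c + q)"
  shows "P p"
proof (induction p rule: Poly_Mapping.update_induct)
  case const
  show ?case by (rule assms(1))
next
  case (update f a b)
  have "Poly_Mapping.update a b f = Poly_Mapping.single a b + f"
    using update(1)
    by (intro poly_mapping_eqI)
       (auto simp: lookup_update lookup_add lookup_single in_keys_iff when_def)
  with assms(2)[OF update(3)] show ?case by simp
qed

text \<open>The product rule, which has multiplicativity of evaluation as a special case.\<close>

lemma lin_ext_product:
  assumes k: "structure_map \<kappa>"
    and D: "\<And>u v. D (u @ v) = D u * F v + E u * D v"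
  shows "lin_ext \<kappa> D (p * q) = lin_ext \<kappa> D p * lin_ext \<kappa> F q + lin_ext \<kappa> E p * lin_ext \<kappa> D q"
proof (induction p rule: free_alg_induct)
  case zero
  show ?case by simp
next
  case (add w c p)
  have comm: "\<kappa> a * x = x * \<kappa> a" for a x by (rule structure_map_central[OF k])
  have pull: "x * (\<kappa> a * y) = \<kappa> a * (x * y)" for a x y
    by (metis comm mult.assoc)
  have "lin_ext \<kappa> D (Poly_Mapping.single w c * q) =
        \<kappa> c * (D w * lin_ext \<kappa> F q + E w * lin_ext \<kappa> D q)" for q
  proof (induction q rule: free_alg_induct)
    case zero
    show ?case by simp
  next
    case (add v d q)
    have "lin_ext \<kappa> D (Poly_Mapping.single w c * (Poly_Mapping.single v d + q)) =
        \<kappa> (c * d) * D (w @ v) + lin_ext \<kappa> D (Poly_Mapping.single w c * q)"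
      using k by (simp add: distrib_left mult_single lin_ext_add lin_ext_single plus_list_def)
    also have "\<kappa> (c * d) = \<kappa> c * \<kappa> d" by (rule structure_map_mult[OF k])
    finally show ?case
      using k by (simp add: add lin_ext_add lin_ext_single D algebra_simps pull[of "D w"] pull[of "E w"])
  qed
  with add show ?case
    using k by (simp add: distrib_right lin_ext_add lin_ext_single algebra_simps)
qed

lemma free_eval_lin_ext: "free_eval \<kappa> g = lin_ext \<kappa> (\<lambda>w. prod_list (map g w))"
  by (simp add: fun_eq_iff free_eval_def lin_ext_def)

lemma free_eval_add:
  "structure_map \<kappa> \<Longrightarrow> free_eval \<kappa> g (p + q) = free_eval \<kappa> g p + free_eval \<kappa> g q"
  by (simp add: free_eval_lin_ext lin_ext_add)

lemma free_eval_mult: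
  assumes "structure_map \<kappa>"
  shows "free_eval \<kappa> g (p * q) = free_eval \<kappa> g p * free_eval \<kappa> g q"
proof -
  let ?D = "\<lambda>w. prod_list (map g w)"
  have "lin_ext \<kappa> ?D (p * q) = lin_ext \<kappa> ?D p * lin_ext \<kappa> ?D q + lin_ext \<kappa> (\<lambda>_. 0) p * lin_ext \<kappa> ?D q"
    by (rule lin_ext_product[OF assms]) simp
  then show ?thesis by (simp add: free_eval_lin_ext lin_ext_def)
qed

lemma free_eval_const: "structure_map \<kappa> \<Longrightarrow> free_eval \<kappa> g (free_const c) = \<kappa> c"
  by (simp add: free_eval_lin_ext lin_ext_single free_const_def)

lemma free_const_one: "free_const 1 = 1"
  using single_one[where 'a = "gen list"] by (simp add: free_const_def zero_list_def)

lemma free_eval_one: "structure_map \<kappa> \<Longrightarrow> free_eval \<kappa> g 1 = 1"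
  using free_eval_const[of \<kappa> g 1] by (simp add: free_const_one structure_map_one)

lemma free_eval_gen: "structure_map \<kappa> \<Longrightarrow> free_eval \<kappa> g (free_gen t) = g t"
  by (simp add: free_eval_lin_ext lin_ext_single free_gen_def structure_map_one)

lemma free_eval_diff:
  "structure_map \<kappa> \<Longrightarrow> free_eval \<kappa> g (p - q) = free_eval \<kappa> g p - free_eval \<kappa> g q"
  by (metis add_diff_cancel diff_add_cancel free_eval_add)

lemma free_eval_comm:
  "structure_map \<kappa> \<Longrightarrow> free_eval \<kappa> g (commutator p q) = commutator (free_eval \<kappa> g p) (free_eval \<kappa> g q)"
  by (simp add: commutator_def free_eval_diff free_eval_mult)

lemma free_eval_metab_ideal:
  fixes g :: "gen \<Rightarrow> 'b::ring_1"
  assumes "structure_map \<kappa>" "\<And>a b c d :: 'b. commutator a b * commutator c d = 0"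
    and "p \<in> metab_ideal"
  shows "free_eval \<kappa> g p = 0"
  using assms(3) unfolding metab_ideal_def
proof (induction rule: two_sided_ideal.induct)
  case zero
  show ?case by (simp add: free_eval_def)
next
  case (base s)
  then show ?case using assms(1,2) by (auto simp: free_eval_mult free_eval_comm)
qed (simp_all add: assms(1) free_eval_add free_eval_mult)

lemma one_notin_metab_ideal: "(1 :: 'k::field free_alg) \<notin> metab_ideal"
proof
  assume "(1 :: 'k free_alg) \<in> metab_ideal"
  then have "free_eval (\<lambda>c. c) (\<lambda>_. 0) (1 :: 'k free_alg) = 0"
    by (intro free_eval_metab_ideal) (auto simp: structure_map_def commutator_def)
  then show False
    by (simp add: free_eval_one structure_map_def)
qed

quotient_type (overloaded) 'k metab = "'k::field free_alg" / metab_rel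
  morphisms rep_metab metab_proj
  by (rule equivp_metab_rel)

instantiation metab :: (field) ring_1
begin

lift_definition zero_metab :: "'a metab" is 0 .

lift_definition one_metab :: "'a metab" is 1 .

lift_definition plus_metab :: "'a metab \<Rightarrow> 'a metab \<Rightarrow> 'a metab" is "(+)"
  unfolding metab_rel_def metab_ideal_def add_diff_add by (rule two_sided_ideal.add)

lift_definition minus_metab :: "'a metab \<Rightarrow> 'a metab \<Rightarrow> 'a metab" is "(-)"
  unfolding metab_rel_def metab_ideal_def
proof -
  fix a b c d :: "'a free_alg"
  let ?I = "two_sided_ideal {commutator a b * commutator c d | a b c d :: 'a free_alg. True}"
  assume "a - b \<in> ?I" "c - d \<in> ?I"
  then have "(a - b) - (c - d) \<in> ?I" by (rule ideal_diff)
  then show "a - c - (b - d) \<in> ?I" by (simp add: algebra_simps)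
qed

lift_definition uminus_metab :: "'a metab \<Rightarrow> 'a metab" is "uminus"
  unfolding metab_rel_def metab_ideal_def minus_diff_minus by (rule ideal_uminus)

lift_definition times_metab :: "'a metab \<Rightarrow> 'a metab \<Rightarrow> 'a metab" is "(*)"
  unfolding metab_rel_def metab_ideal_def
proof -
  fix a b c d :: "'a free_alg"
  let ?I = "two_sided_ideal {commutator a b * commutator c d | a b c d :: 'a free_alg. True}"
  assume "a - b \<in> ?I" "c - d \<in> ?I"
  then have "(a - b) * c + b * (c - d) \<in> ?I"
    by (intro two_sided_ideal.add two_sided_ideal.lmult two_sided_ideal.rmult)
  then show "a * c - b * d \<in> ?I" by (simp add: algebra_simps)
qed

instance
proof
  fix a b c :: "'a metab"
  have refl: "metab_rel p p" for p :: "'a free_alg"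
    using equivp_reflp[OF equivp_metab_rel] .
  show "a * b * c = a * (b * c)" "a + b + c = a + (b + c)"
    "(a + b) * c = a * c + b * c" "a * (b + c) = a * b + a * c"
    "a + b = b + a" "0 + a = a" "- a + a = 0" "a - b = a + - b" "1 * a = a" "a * 1 = a"
    by (transfer, simp add: algebra_simps refl)+
  show "(0 :: 'a metab) \<noteq> 1"
  proof (transfer, rule notI)
    assume "metab_rel (0 :: 'a free_alg) 1"
    then have "metab_rel (1 :: 'a free_alg) 0"
      using equivp_symp[OF equivp_metab_rel] by blast
    then show False using one_notin_metab_ideal[where 'k = 'a] by (simp add: metab_rel_def)
  qed
qed

end

lift_definition metab_const :: "'k::field \<Rightarrow> 'k metab" is free_const .

lift_definition metab_gen :: "gen \<Rightarrow> 'k::field metab" is free_gen .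

lemma structure_map_free_const: "structure_map (free_const :: 'k::field \<Rightarrow> _)"
proof -
  have "free_const a * x = x * free_const a" for a :: 'k and x
  proof (induction x rule: free_alg_induct)
    case (add w c x)
    then show ?case
      by (simp add: distrib_left distrib_right free_const_def mult_single plus_list_def mult.commute)
  qed simp
  moreover have "free_const (a + b) = free_const a + free_const b"
    "free_const (a * b) = free_const a * free_const b" for a b :: 'k
    by (simp_all add: free_const_def single_add mult_single plus_list_def)
  ultimately show ?thesis
    unfolding structure_map_def using free_const_one by blast
qed

lemma structure_map_metab_const: "structure_map (metab_const :: 'k::field \<Rightarrow> _)"
proof -
  have refl: "metab_rel p q" if "p = q" for p q :: "'k free_alg"
    using equivp_reflp[OF equivp_metab_rel] that by blast
  have "metab_const 1 = (1 :: 'k metab)"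
    by transfer (rule refl, rule free_const_one)
  moreover have "metab_const (a + b) = metab_const a + metab_const b" for a b :: 'k
    by transfer (rule refl, rule structure_map_add[OF structure_map_free_const])
  moreover have "metab_const (a * b) = metab_const a * metab_const b" for a b :: 'k
    by transfer (rule refl, rule structure_map_mult[OF structure_map_free_const])
  moreover have "metab_const a * x = x * metab_const a" for a :: 'k and x
    by transfer (rule refl, rule structure_map_central[OF structure_map_free_const])
  ultimately show ?thesis
    unfolding structure_map_def by blast
qed

lemma metab_comm_mult:
  fixes a b c d :: "'k::field metab"
  shows "commutator a b * commutator c d = 0"
  unfolding commutator_def
proof transfer
  fix a b c d :: "'k free_alg"
  have "commutator a b * commutator c d \<in> metab_ideal"
    unfolding metab_ideal_def by (rule two_sided_ideal.base) blast
  then show "metab_rel ((a * b - b * a) * (c * d - d * c)) 0"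
    by (simp add: metab_rel_def commutator_def)
qed

lift_definition metab_subst :: "(gen \<Rightarrow> 'k::field metab) \<Rightarrow> 'k metab \<Rightarrow> 'k metab"
  is "\<lambda>g. free_eval metab_const g"
proof -
  fix g :: "gen \<Rightarrow> 'k metab" and p q :: "'k free_alg"
  assume "metab_rel p q"
  then have "free_eval metab_const g (p - q) = 0"
    unfolding metab_rel_def
    by (intro free_eval_metab_ideal structure_map_metab_const metab_comm_mult)
  then show "free_eval metab_const g p = free_eval metab_const g q"
    by (simp add: free_eval_diff structure_map_metab_const)
qed

text \<open>The endomorphism \<open>(f, g, h)\<close> of the free metabelian algebra.\<close>

definition metab_endo :: "'k::field metab \<Rightarrow> 'k metab \<Rightarrow> 'k metab \<Rightarrow> 'k metab \<Rightarrow> 'k metab" where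
  "metab_endo f g h = metab_subst (case_gen f g h)"

lemma metab_endo_gen [simp]:
  "metab_endo f g h (metab_gen X) = f"
  "metab_endo f g h (metab_gen Y) = g"
  "metab_endo f g h (metab_gen Z) = h"
  by (simp_all add: metab_endo_def metab_gen_def metab_subst.abs_eq free_eval_gen
      structure_map_metab_const)

lemma alg_endo_metab_endo: "alg_endo metab_const (metab_endo f g h)"
proof -
  let ?g = "case_gen f g h"
  note k = structure_map_metab_const
  have "metab_subst ?g 1 = 1"
    by (simp add: one_metab_def metab_subst.abs_eq free_eval_one[OF k])
  moreover have "metab_subst ?g (a + b) = metab_subst ?g a + metab_subst ?g b" for a b
    by (induction a rule: metab.abs_induct, induction b rule: metab.abs_induct)
       (simp add: plus_metab.abs_eq metab_subst.abs_eq free_eval_add[OF k])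
  moreover have "metab_subst ?g (a * b) = metab_subst ?g a * metab_subst ?g b" for a b
    by (induction a rule: metab.abs_induct, induction b rule: metab.abs_induct)
       (simp add: times_metab.abs_eq metab_subst.abs_eq free_eval_mult[OF k])
  moreover have "metab_subst ?g (metab_const c) = metab_const c" for c
    using free_eval_const[OF k, of ?g c]
    by (simp add: metab_const.abs_eq metab_subst.abs_eq)
  ultimately show ?thesis
    unfolding alg_endo_def metab_endo_def by blast
qed


section \<open>Tame, wild and liftable automorphisms\<close>

text \<open>Polynomials in the two generators other than \<open>t\<close>.\<close>

definition metab_without :: "gen \<Rightarrow> 'k::field metab set" where
  "metab_without t = metab_proj ` {p. \<forall>w\<in>Poly_Mapping.keys p. t \<notin> set w}"

definition elementary_aut :: "('k::field metab \<Rightarrow> 'k metab) \<Rightarrow> bool" where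
  "elementary_aut \<phi> \<longleftrightarrow> alg_aut metab_const \<phi> \<and>
     (\<exists>t \<alpha> p. \<alpha> \<noteq> 0 \<and> p \<in> metab_without t \<and>
        \<phi> (metab_gen t) = metab_const \<alpha> * metab_gen t + p \<and>
        (\<forall>s. s \<noteq> t \<longrightarrow> \<phi> (metab_gen s) = metab_gen s))"

inductive tame :: "('k::field metab \<Rightarrow> 'k metab) \<Rightarrow> bool" where
  tame_id: "tame id"
| tame_elementary: "elementary_aut \<phi> \<Longrightarrow> tame \<phi>"
| tame_comp: "tame \<phi> \<Longrightarrow> tame \<psi> \<Longrightarrow> tame (\<phi> \<circ> \<psi>)"
| tame_inv: "tame \<phi> \<Longrightarrow> tame (inv \<phi>)"

definition wild :: "('k::field metab \<Rightarrow> 'k metab) \<Rightarrow> bool" where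
  "wild \<phi> \<longleftrightarrow> alg_aut metab_const \<phi> \<and> \<not> tame \<phi>"

definition liftable :: "('k::field metab \<Rightarrow> 'k metab) \<Rightarrow> bool" where
  "liftable \<phi> \<longleftrightarrow>
     (\<exists>\<sigma>. alg_aut free_const \<sigma> \<and> (\<forall>p. metab_proj (\<sigma> p) = \<phi> (metab_proj p)))"


section \<open>Partial derivatives and the Jacobian matrix\<close>

text \<open>\<open>Var1 t\<close> and \<open>Var2 t\<close> index the commuting variables \<open>t\<^sub>1\<close> and \<open>t\<^sub>2\<close>.\<close>

datatype pvar = Var1 gen | Var2 gen

type_synonym 'k cpoly = "(pvar \<Rightarrow>\<^sub>0 nat) \<Rightarrow>\<^sub>0 'k"

definition cpoly_const :: "'k::field \<Rightarrow> 'k cpoly" where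
  "cpoly_const c = Poly_Mapping.single 0 c"

definition cvar :: "pvar \<Rightarrow> 'k::field cpoly" where
  "cvar v = Poly_Mapping.single (Poly_Mapping.single v 1) 1"

definition pd_word :: "gen \<Rightarrow> gen list \<Rightarrow> 'k::field cpoly" where
  "pd_word t w = (\<Sum>k | k < length w \<and> w ! k = t.
     (\<Prod>s\<leftarrow>take k w. cvar (Var1 s)) * (\<Prod>s\<leftarrow>drop (Suc k) w. cvar (Var2 s)))"

definition pd_free :: "gen \<Rightarrow> 'k::field free_alg \<Rightarrow> 'k cpoly" where
  "pd_free t p =
     (\<Sum>w\<in>Poly_Mapping.keys p. cpoly_const (Poly_Mapping.lookup p w) * pd_word t w)"

lemma structure_map_cpoly_const: "structure_map (cpoly_const :: 'k::field \<Rightarrow> _)"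
  by (simp add: structure_map_def cpoly_const_def single_add mult_single mult.commute)

lemma pd_free_lin_ext: "pd_free t = lin_ext cpoly_const (pd_word t)"
  by (simp add: fun_eq_iff pd_free_def lin_ext_def)

lemma pd_word_Nil: "pd_word t [] = 0"
  by (simp add: pd_word_def)

lemma pd_word_Cons:
  "pd_word t (a # w) =
     (if a = t then \<Prod>s\<leftarrow>w. cvar (Var2 s) else 0) + cvar (Var1 a) * pd_word t w"
proof -
  have *: "pd_word t w = (\<Sum>k<length w. if w ! k = t then
      (\<Prod>s\<leftarrow>take k w. cvar (Var1 s)) * (\<Prod>s\<leftarrow>drop (Suc k) w. cvar (Var2 s)) else 0)" for w
    unfolding pd_word_def by (intro sum.mono_neutral_cong_left) auto
  show ?thesis
    unfolding * by (simp add: sum.lessThan_Suc_shift sum_distrib_left if_distrib mult.assoc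
        del: sum.lessThan_Suc cong: if_cong)
qed

lemma pd_word_append:
  "pd_word t (u @ v) =
     pd_word t u * (\<Prod>s\<leftarrow>v. cvar (Var2 s)) + (\<Prod>s\<leftarrow>u. cvar (Var1 s)) * pd_word t v"
  by (induction u) (simp_all add: pd_word_Nil pd_word_Cons algebra_simps)

lemma pd_free_mult:
  "pd_free t (p * q) =
     pd_free t p * free_eval cpoly_const (\<lambda>s. cvar (Var2 s)) q +
     free_eval cpoly_const (\<lambda>s. cvar (Var1 s)) p * pd_free t q"
  unfolding pd_free_lin_ext free_eval_lin_ext
  by (rule lin_ext_product[OF structure_map_cpoly_const]) (rule pd_word_append)

lemma pd_free_add: "pd_free t (p + q) = pd_free t p + pd_free t q"
  unfolding pd_free_lin_ext by (rule lin_ext_add[OF structure_map_cpoly_const])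

lemma pd_free_diff: "pd_free t (p - q) = pd_free t p - pd_free t q"
  by (metis add_diff_cancel diff_add_cancel pd_free_add)

lemma pd_free_metab_ideal:
  assumes "p \<in> metab_ideal"
  shows "pd_free t p = 0"
proof -
  have comm0: "free_eval cpoly_const g (commutator a b) = 0" for g :: "gen \<Rightarrow> 'a cpoly" and a b
    unfolding free_eval_comm[OF structure_map_cpoly_const] by (simp add: commutator_def mult.commute)
  have ev: "free_eval cpoly_const g p = 0"
    if "p \<in> metab_ideal" for g :: "gen \<Rightarrow> 'a cpoly" and p
    using that structure_map_cpoly_const
    by (intro free_eval_metab_ideal) (auto simp: commutator_def mult.commute)
  show ?thesis
    using assms unfolding metab_ideal_def
  proof (induction rule: two_sided_ideal.induct)
    case zero
    show ?case by (simp add: pd_free_def)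
  next
    case (base s)
    then show ?case by (auto simp: pd_free_mult comm0)
  next
    case (lmult p a)
    then show ?case using ev[of p] by (simp add: pd_free_mult metab_ideal_def)
  next
    case (rmult p a)
    then show ?case using ev[of p] by (simp add: pd_free_mult metab_ideal_def)
  qed (simp add: pd_free_add)
qed

lift_definition pd_metab :: "gen \<Rightarrow> 'k::field metab \<Rightarrow> 'k cpoly" is pd_free
  using pd_free_metab_ideal by (fastforce simp: metab_rel_def pd_free_diff)

text \<open>
  Rows are indexed by the derivation, columns by the component of \<open>\<phi>\<close>; the matrix index type
  \<open>3\<close> enumerates \<open>X, Y, Z\<close> in this order.
\<close>

definition jacobian_metab :: "('k::field metab \<Rightarrow> 'k metab) \<Rightarrow> 'k cpoly ^ 3 ^ 3" where
  "jacobian_metab \<phi> =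
     vector [vector [pd_metab s (\<phi> (metab_gen t)). t \<leftarrow> [X, Y, Z]]. s \<leftarrow> [X, Y, Z]]"

definition elementary_matrix :: "'a::comm_ring_1 ^ 'n ^ 'n \<Rightarrow> bool" where
  "elementary_matrix A \<longleftrightarrow>
     (\<exists>i j. i \<noteq> j \<and> (\<forall>k l. (k, l) \<noteq> (i, j) \<longrightarrow> A $ k $ l = mat 1 $ k $ l))"

end

theory Submission
  imports Defs "HOL-Computational_Algebra.Polynomial"
begin

text \<open>
  Since \<open>[y, z] r [y, z] = 0\<close> holds in the free metabelian algebra for every \<open>r\<close>, the substitution
  \<open>x \<mapsto> x - x\<^sup>2[y, z]\<close> inverts \<open>\<tau>\<close>. Elementary automorphisms of the metabelian algebra lift to the free
  algebra, hence all tame ones do (\<open>tame_imp_liftable\<close>), and wildness follows once \<open>\<tau>\<close> is known not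
  to lift.

  The obstruction to lifting is a trace. Let \<open>\<sigma>\<close> be an automorphism of \<open>K\<langle>x, y, z\<rangle>\<close> with
  \<open>\<sigma>(t) = t +\<close> (terms of degree at least \<open>4\<close>), and write \<open>\<sigma>(t) = \<Sum>\<^sub>s s a\<^sub>s\<^sub>t\<close>. By the chain rule the
  matrix \<open>(a\<^sub>s\<^sub>t)\<close> over the free algebra is invertible. Representing the free algebra by
  \<open>x \<mapsto> T E\<^sub>1\<^sub>2\<close>, \<open>y \<mapsto> T E\<^sub>2\<^sub>3\<close>, \<open>z \<mapsto> T E\<^sub>3\<^sub>1\<close> turns it into an invertible \<open>9 \<times> 9\<close> matrix over \<open>K[T]\<close>,
  whose determinant is a unit of \<open>K[T]\<close> and so a constant. The matrix is congruent to \<open>1\<close> modulo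
  \<open>T\<^sup>3\<close>; hence the coefficient of \<open>T\<^sup>3\<close> in its determinant is the trace of its degree \<open>3\<close> part, and
  this trace is \<open>0\<close>. A word of length \<open>3\<close> has nonzero trace only if it is one of \<open>c = xyz, yzx, zxy\<close>.
  So the coefficients of \<open>s c\<close> in \<open>\<sigma>(s)\<close>, summed over \<open>s\<close> and \<open>c\<close>, add up to \<open>0\<close>. Expanding
  \<open>\<sigma>(t) = \<Sum>\<^sub>s b\<^sub>s\<^sub>t s\<close> instead gives the same for the coefficients of \<open>c s\<close>
  (\<open>automorphism_cycle_sums\<close>).

  A lift of \<open>\<tau>\<close> sends \<open>x\<close> to \<open>x + x\<^sup>2[y, z]\<close> and fixes \<open>y\<close> and \<open>z\<close>, up to elements of the ideal
  generated by all \<open>[a, b][c, d]\<close>. Such elements have degree at least \<open>4\<close> and contribute equally to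
  the two sums (\<open>metab_ideal_order_and_traces\<close>). But \<open>x\<^sup>2[y, z] = xxyz - xxzy\<close> contributes \<open>1\<close> to the
  first sum and \<open>0\<close> to the second, so the two sums cannot both vanish. The first sum alone is no
  obstruction: it does vanish for \<open>x\<^sup>2[y, z] - [x, z][x, y]\<close>.
\<close>

section \<open>The free algebra in low degrees\<close>

text \<open>Pairs of generators will index the rows and columns of matrices.\<close>

instance gen :: finite
proof
  have "(UNIV :: gen set) \<subseteq> {X, Y, Z}"
    using gen.exhaust by blast
  then show "finite (UNIV :: gen set)"
    by (rule finite_subset) simp
qed

lemma UNIV_gen: "UNIV = {X, Y, Z}"
  using gen.exhaust by blast

lemma all_gen: "(\<forall>s. P s) \<longleftrightarrow> P X \<and> P Y \<and> P Z"
  by (metis gen.exhaust)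

lemma sum_gen: "(\<Sum>s\<in>UNIV. f s) = f X + f Y + f Z"
  by (simp add: UNIV_gen add.assoc)

lemma lookup_single_mult:
  fixes q :: "'k::field free_alg"
  shows "Poly_Mapping.lookup (Poly_Mapping.single u c * q) w =
    (if take (length u) w = u then c * Poly_Mapping.lookup q (drop (length u) w) else 0)"
proof (induction q rule: free_alg_induct)
  case zero
  show ?case by simp
next
  case (add v d q)
  have "u @ v = w \<longleftrightarrow> take (length u) w = u \<and> v = drop (length u) w"
    by (metis append_eq_conv_conj)
  then show ?case
    by (auto simp add: distrib_left lookup_add mult_single plus_list_def lookup_single when_def add
        algebra_simps simp del: take_all_iff)
qed

lemma lookup_mult_free:
  fixes p q :: "'k::field free_alg"
  shows "Poly_Mapping.lookup (p * q) w =
    (\<Sum>i\<le>length w. Poly_Mapping.lookup p (take i w) * Poly_Mapping.lookup q (drop i w))"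
proof (induction p rule: free_alg_induct)
  case zero
  show ?case by simp
next
  case (add u c p)
  have "(\<Sum>i\<le>length w. Poly_Mapping.lookup (Poly_Mapping.single u c) (take i w)
        * Poly_Mapping.lookup q (drop i w))
      = (\<Sum>i\<le>length w. if i = length u then
          (if take (length u) w = u then c * Poly_Mapping.lookup q (drop (length u) w) else 0)
          else 0)"
    by (intro sum.cong) (auto simp: lookup_single when_def)
  also have "\<dots> = Poly_Mapping.lookup (Poly_Mapping.single u c * q) w"
    by (simp add: lookup_single_mult) auto
  finally show ?case
    by (simp add: distrib_right lookup_add add sum.distrib)
qed

lemma lookup_free_gen_Nil: "Poly_Mapping.lookup (free_gen s) [] = 0"
  by (simp add: free_gen_def lookup_single)

lemma free_const_zero: "free_const 0 = 0"
  by (simp add: free_const_def)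

lemma lookup_const_mult:
  "Poly_Mapping.lookup (free_const c * q) w = c * Poly_Mapping.lookup q w"
  by (simp add: free_const_def lookup_single_mult)

definition order_ge :: "nat \<Rightarrow> 'k::field free_alg \<Rightarrow> bool" where
  "order_ge n p \<longleftrightarrow> (\<forall>w. length w < n \<longrightarrow> Poly_Mapping.lookup p w = 0)"

lemma order_ge_mult:
  assumes "order_ge m p" "order_ge n q"
  shows "order_ge (m + n) (p * q)"
  unfolding order_ge_def lookup_mult_free
proof (intro allI impI sum.neutral ballI)
  fix w :: "gen list" and i
  assume "length w < m + n" "i \<in> {..length w}"
  then have "length (take i w) < m \<or> length (drop i w) < n" by auto
  then show "Poly_Mapping.lookup p (take i w) * Poly_Mapping.lookup q (drop i w) = 0"
    using assms unfolding order_ge_def by auto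
qed

lemma lookup_mult_leading:
  assumes "order_ge m p" "order_ge n q" "length w = m + n"
  shows "Poly_Mapping.lookup (p * q) w =
    Poly_Mapping.lookup p (take m w) * Poly_Mapping.lookup q (drop m w)"
proof -
  \<comment> \<open>Splitting \<open>w\<close> anywhere but after \<open>m\<close> letters makes one of the two factors too short.\<close>
  have "Poly_Mapping.lookup p (take i w) * Poly_Mapping.lookup q (drop i w) = 0"
    if "i \<in> {..length w} - {m}" for i
  proof -
    have "length (take i w) < m \<or> length (drop i w) < n" using that assms(3) by auto
    then show ?thesis using assms(1,2) unfolding order_ge_def by auto
  qed
  then have "(\<Sum>i\<in>{m}. Poly_Mapping.lookup p (take i w) * Poly_Mapping.lookup q (drop i w)) =
      Poly_Mapping.lookup (p * q) w"
    unfolding lookup_mult_free using assms(3) by (intro sum.mono_neutral_left) auto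
  then show ?thesis by simp
qed

text \<open>
  In degree at most \<open>1\<close> the free algebra is commutative, as a word with at most one letter
  has only trivial factorisations; this leaves degree \<open>2\<close> as the first one in which a commutator
  lives, and there the contributions of the constant terms cancel.
\<close>

lemma
  fixes a b :: "'k::field free_alg"
  shows order_ge_commutator: "order_ge 2 (commutator a b)"
    and lookup_commutator_swap: "Poly_Mapping.lookup (commutator a b) [u, v] =
      - Poly_Mapping.lookup (commutator a b) [v, u]"
proof -
  show "order_ge 2 (commutator a b)"
    unfolding order_ge_def
  proof (intro allI impI)
    fix w :: "gen list"
    assume "length w < 2"
    then consider "w = []" | s where "w = [s]"
      by (cases w rule: remdups_adj.cases) auto
    then show "Poly_Mapping.lookup (commutator a b) w = 0"
      by cases (simp_all add: commutator_def lookup_minus lookup_mult_free)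
  qed
  show "Poly_Mapping.lookup (commutator a b) [u, v] =
      - Poly_Mapping.lookup (commutator a b) [v, u]"
    by (simp add: commutator_def lookup_minus lookup_mult_free numeral_2_eq_2)
qed

section \<open>The metabelian ideal in degree four\<close>

primrec rot :: "gen \<Rightarrow> gen" where
  "rot X = Y" | "rot Y = Z" | "rot Z = X"

text \<open>As \<open>u\<close> varies, these are the cyclic rotations of \<open>xyz\<close>.\<close>

definition cyc :: "gen \<Rightarrow> gen list" where
  "cyc u = [u, rot u, rot (rot u)]"

text \<open>
  In degree \<open>4\<close> a product \<open>[a, b][c, d]\<close> is the product of the degree \<open>2\<close> parts of the two
  commutators. Both parts are alternating, so transposing the first two letters together with the
  last two leaves a coefficient unchanged. For \<open>s = x\<close>, for example, the word \<open>xyzx\<close> is counted on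
  both sides, \<open>xzxy\<close> on the left corresponds to \<open>zxyx\<close> on the right, and the coefficients of \<open>xxyz\<close>
  and \<open>yzxx\<close> vanish. Terms of the ideal can therefore never make the two sums differ.
\<close>

lemma metab_ideal_order_and_traces:
  assumes "p \<in> (metab_ideal :: 'k::field free_alg set)"
  shows "order_ge 4 p \<and>
    (\<forall>s. (\<Sum>u\<in>UNIV. Poly_Mapping.lookup p (s # cyc u)) =
         (\<Sum>u\<in>UNIV. Poly_Mapping.lookup p (cyc u @ [s])))"
  using assms unfolding metab_ideal_def
proof (induction rule: two_sided_ideal.induct)
  case zero
  show ?case by (simp add: order_ge_def)
next
  case (base s)
  then obtain a b c d where s: "s = commutator a b * commutator c d" by blast
  let ?f = "Poly_Mapping.lookup (commutator a b)" and ?g = "Poly_Mapping.lookup (commutator c d)"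
  have "order_ge (2 + 2) s"
    unfolding s by (intro order_ge_mult order_ge_commutator)
  moreover have "Poly_Mapping.lookup s [i, j, k, l] = ?f [i, j] * ?g [k, l]" for i j k l
    unfolding s
    by (subst lookup_mult_leading[OF order_ge_commutator order_ge_commutator]) simp_all
  moreover have "?f [i, i] = 0" "?g [i, i] = 0" for i
    by (simp_all add: commutator_def lookup_minus lookup_mult_free numeral_2_eq_2)
  moreover have "?f [i, j] * ?g [k, l] = ?f [j, i] * ?g [l, k]" for i j k l
    using lookup_commutator_swap[of a b i j] lookup_commutator_swap[of c d k l] by simp
  then have "?f [X, Z] * ?g [X, Y] = ?f [Z, X] * ?g [Y, X]"
    "?f [Y, X] * ?g [Y, Z] = ?f [X, Y] * ?g [Z, Y]"
    "?f [Z, Y] * ?g [Z, X] = ?f [Y, Z] * ?g [X, Z]"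
    by blast+
  ultimately show ?case
    by (simp add: all_gen sum_gen cyc_def)
next
  case (add p q)
  then show ?case by (simp add: order_ge_def lookup_add sum.distrib)
next
  case (lmult p a)
  \<comment> \<open>In degree \<open>4\<close> only the constant term of \<open>a\<close> acts, and it scales both sums.\<close>
  have "order_ge 0 a" by (simp add: order_ge_def)
  with order_ge_mult[OF this, of 4 p] lookup_mult_leading[OF this, of 4 p] lmult show ?case
    by (simp add: cyc_def flip: sum_distrib_left)
next
  case (rmult p a)
  have "order_ge 0 a" by (simp add: order_ge_def)
  with order_ge_mult[OF _ this, of 4 p] lookup_mult_leading[OF _ this, of 4 p] rmult show ?case
    by (simp add: cyc_def flip: sum_distrib_right)
qed

section \<open>Fox derivatives\<close>

text \<open>
  The coefficients \<open>p\<^sub>s\<close> in \<open>p = \<epsilon>(p) + \<Sum>\<^sub>s s p\<^sub>s\<close>, where \<open>\<epsilon>\<close> is the constant term. They are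
  the noncommutative (Fox) derivatives of \<open>p\<close>, with the letters to the left of the
  differentiated one specialised to \<open>0\<close>. As \<open>p\<^sub>s\<close> collects the words that begin with \<open>s\<close>, it arises by re-indexing along \<open>w \<mapsto> s w\<close>.
\<close>

definition left_fox :: "gen \<Rightarrow> 'k::field free_alg \<Rightarrow> 'k free_alg" where
  "left_fox s = Poly_Mapping.map_key ((#) s)"

text \<open>
  The mirror image: the coefficients in \<open>p = \<epsilon>(p) + \<Sum>\<^sub>s p\<^sub>s s\<close>.
\<close>

definition right_fox :: "gen \<Rightarrow> 'k::field free_alg \<Rightarrow> 'k free_alg" where
  "right_fox s = Poly_Mapping.map_key (\<lambda>w. w @ [s])"

lemma lookup_left_fox [simp]: "Poly_Mapping.lookup (left_fox s p) w = Poly_Mapping.lookup p (s # w)"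
  by (simp add: left_fox_def map_key.rep_eq)

lemma lookup_right_fox [simp]:
  "Poly_Mapping.lookup (right_fox s p) w = Poly_Mapping.lookup p (w @ [s])"
  by (simp add: right_fox_def map_key.rep_eq inj_on_def)

lemma order_ge_fox:
  assumes "order_ge (Suc n) p"
  shows "order_ge n (left_fox s p)" "order_ge n (right_fox s p)"
  using assms by (simp_all add: order_ge_def)

lemma fox_add:
  "left_fox s (p + q) = left_fox s p + left_fox s q"
  "right_fox s (p + q) = right_fox s p + right_fox s q"
  by (simp_all add: poly_mapping_eqI lookup_add)

lemma fox_diff:
  "left_fox s (p - q) = left_fox s p - left_fox s q"
  "right_fox s (p - q) = right_fox s p - right_fox s q"
  by (simp_all add: poly_mapping_eqI lookup_minus)

lemma fox_zero: "left_fox s 0 = 0" "right_fox s 0 = 0"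
  by (simp_all add: poly_mapping_eqI)

lemma fox_sum:
  "left_fox s (sum f A) = (\<Sum>a\<in>A. left_fox s (f a))"
  "right_fox s (sum f A) = (\<Sum>a\<in>A. right_fox s (f a))"
  by (induction A rule: infinite_finite_induct) (simp_all add: fox_add fox_zero)

lemma fox_const: "left_fox s (free_const c) = 0" "right_fox s (free_const c) = 0"
  by (simp_all add: poly_mapping_eqI free_const_def lookup_single)

lemma fox_gen:
  "left_fox s (free_gen t) = of_bool (s = t)" "right_fox s (free_gen t) = of_bool (s = t)"
  by (auto intro!: poly_mapping_eqI simp: free_gen_def lookup_single lookup_one when_def zero_list_def)

lemma left_fox_mult:
  "left_fox s (p * q) = left_fox s p * q + free_const (Poly_Mapping.lookup p []) * left_fox s q"
  by (rule poly_mapping_eqI)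
     (simp add: lookup_add lookup_const_mult lookup_mult_free[of p q]
       lookup_mult_free[of "left_fox s p" q] sum.atMost_Suc_shift
        del: sum.atMost_Suc)

lemma right_fox_mult:
  "right_fox s (p * q) = p * right_fox s q + free_const (Poly_Mapping.lookup q []) * right_fox s p"
  by (rule poly_mapping_eqI) (simp add: lookup_add lookup_const_mult lookup_mult_free[of p q]
       lookup_mult_free[of p "right_fox s q"])

lemma left_fox_expansion:
  "p = free_const (Poly_Mapping.lookup p []) + (\<Sum>s\<in>UNIV. free_gen s * left_fox s p)"
proof (rule poly_mapping_eqI)
  fix w
  show "Poly_Mapping.lookup p w = Poly_Mapping.lookup
    (free_const (Poly_Mapping.lookup p []) + (\<Sum>s\<in>UNIV. free_gen s * left_fox s p)) w"
  proof (cases w)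
    case Nil
    then show ?thesis
      by (simp add: lookup_add sum_gen lookup_mult_free free_gen_def free_const_def lookup_single)
  next
    case (Cons a v)
    have "Poly_Mapping.lookup p w = Poly_Mapping.lookup (left_fox a
      (free_const (Poly_Mapping.lookup p []) + (\<Sum>s\<in>UNIV. free_gen s * left_fox s p))) v"
      by (simp add: Cons fox_add fox_sum left_fox_mult fox_const fox_gen lookup_add
        lookup_free_gen_Nil free_const_zero sum_gen) (cases a; simp)
    then show ?thesis by (simp add: Cons)
  qed
qed

lemma right_fox_expansion:
  "p = free_const (Poly_Mapping.lookup p []) + (\<Sum>s\<in>UNIV. right_fox s p * free_gen s)"
proof (rule poly_mapping_eqI)
  fix w
  show "Poly_Mapping.lookup p w = Poly_Mapping.lookup
    (free_const (Poly_Mapping.lookup p []) + (\<Sum>s\<in>UNIV. right_fox s p * free_gen s)) w"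
  proof (cases w rule: rev_cases)
    case Nil
    then show ?thesis
      by (simp add: lookup_add sum_gen lookup_mult_free free_gen_def free_const_def lookup_single)
  next
    case (snoc v a)
    have "Poly_Mapping.lookup p w = Poly_Mapping.lookup (right_fox a
      (free_const (Poly_Mapping.lookup p []) + (\<Sum>s\<in>UNIV. right_fox s p * free_gen s))) v"
      by (simp add: snoc fox_add fox_sum right_fox_mult fox_const fox_gen lookup_add
        lookup_free_gen_Nil free_const_zero sum_gen) (cases a; simp)
    then show ?thesis by (simp add: snoc)
  qed
qed

lemma alg_endo_sum:
  assumes "alg_endo \<kappa> \<sigma>"
  shows "\<sigma> (sum f A) = (\<Sum>a\<in>A. \<sigma> (f a))"
proof -
  have add: "\<sigma> (a + b) = \<sigma> a + \<sigma> b" for a b using assms by (simp add: alg_endo_def)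
  have "\<sigma> 0 = 0" using add[of 0 0] by simp
  then show ?thesis
    by (induction A rule: infinite_finite_induct) (simp_all add: add)
qed

text \<open>
  Apply \<open>\<sigma>\<close> to the expansion \<open>p = \<epsilon>(p) + \<Sum>\<^sub>t t p\<^sub>t\<close> and differentiate: since \<open>\<sigma>(t)\<close> has no constant term,
  the product rule leaves only the derivative of the factor \<open>\<sigma>(t)\<close>.
\<close>

lemma fox_chain_rule:
  assumes endo: "alg_endo free_const \<sigma>"
    and aug: "\<And>t. Poly_Mapping.lookup (\<sigma> (free_gen t)) [] = 0"
  shows "left_fox s (\<sigma> p) = (\<Sum>t\<in>UNIV. left_fox s (\<sigma> (free_gen t)) * \<sigma> (left_fox t p))"
    and "right_fox s (\<sigma> p) = (\<Sum>t\<in>UNIV. \<sigma> (right_fox t p) * right_fox s (\<sigma> (free_gen t)))"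
proof -
  have hom: "\<sigma> (a + b) = \<sigma> a + \<sigma> b" "\<sigma> (a * b) = \<sigma> a * \<sigma> b" "\<sigma> (free_const c) = free_const c" for a b c
    using endo by (simp_all add: alg_endo_def)
  show "left_fox s (\<sigma> p) = (\<Sum>t\<in>UNIV. left_fox s (\<sigma> (free_gen t)) * \<sigma> (left_fox t p))"
    by (subst left_fox_expansion[of p])
       (simp add: hom alg_endo_sum[OF endo] fox_add fox_sum fox_const left_fox_mult aug free_const_zero)
  show "right_fox s (\<sigma> p) = (\<Sum>t\<in>UNIV. \<sigma> (right_fox t p) * right_fox s (\<sigma> (free_gen t)))"
    by (subst right_fox_expansion[of p])
       (simp add: hom alg_endo_sum[OF endo] fox_add fox_sum fox_const right_fox_mult aug free_const_zero)
qed

section \<open>Determinants close to one\<close>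

lemma dvd_prod_two:
  fixes f :: "'a \<Rightarrow> 'b::comm_monoid_mult"
  assumes "finite A" "i \<in> A" "j \<in> A" "i \<noteq> j" "a dvd f i" "b dvd f j"
  shows "a * b dvd prod f A"
proof -
  have "prod f A = f i * (f j * prod f (A - {i} - {j}))"
    using assms by (simp add: prod.remove[of A i] prod.remove[of "A - {i}" j])
  with assms show ?thesis by (simp add: mult_dvd_mono mult.assoc[symmetric])
qed

text \<open>Expanding the product, every term after the linear ones contains two of the \<open>e i\<close>.\<close>

lemma dvd_prod_one_plus_minus_linear:
  fixes e :: "'a \<Rightarrow> 'b::comm_ring_1"
  assumes "finite A" "\<And>i. i \<in> A \<Longrightarrow> c dvd e i"
  shows "c * c dvd (\<Prod>i\<in>A. 1 + e i) - 1 - (\<Sum>i\<in>A. e i)"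
  using assms
proof (induction A rule: finite_induct)
  case empty
  then show ?case by simp
next
  case (insert j A)
  let ?r = "(\<Prod>i\<in>A. 1 + e i) - 1 - (\<Sum>i\<in>A. e i)"
  have "c dvd (\<Sum>i\<in>A. e i)" by (rule dvd_sum) (simp add: insert)
  then have "c * c dvd e j * (\<Sum>i\<in>A. e i)" by (intro mult_dvd_mono) (simp_all add: insert)
  moreover have "c * c dvd (1 + e j) * ?r" using insert by (simp add: dvd_mult)
  moreover have "(\<Prod>i\<in>insert j A. 1 + e i) - 1 - (\<Sum>i\<in>insert j A. e i)
      = (1 + e j) * ?r + e j * (\<Sum>i\<in>A. e i)"
    using insert by (simp add: algebra_simps)
  ultimately show ?case by (simp add: dvd_add)
qed

text \<open>
  To first order in \<open>c\<close>, the determinant of \<open>1 + c N\<close> is \<open>1 + c tr N\<close>. In the expansion over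
  permutations, each permutation other than the identity meets at least two off-diagonal entries.
\<close>

lemma det_minus_one_minus_trace_dvd:
  fixes A :: "'a::comm_ring_1 ^ 'n ^ 'n"
  assumes A: "\<And>i j. c dvd (A - mat 1) $ i $ j"
  shows "c * c dvd det A - 1 - (\<Sum>i\<in>UNIV. (A - mat 1) $ i $ i)"
proof -
  let ?T = "\<lambda>p. of_int (sign p) * (\<Prod>i\<in>UNIV. A $ i $ p i)"
  let ?P = "{p. p permutes (UNIV :: 'n set)}"
  have fin: "finite ?P" by (simp add: finite_permutations)
  have "c * c dvd (\<Sum>p\<in>?P - {id}. ?T p)"
  proof (rule dvd_sum)
    fix p assume p: "p \<in> ?P - {id}"
    \<comment> \<open>A permutation moving \<open>i\<close> also moves \<open>p i\<close>, which gives two off-diagonal factors.\<close>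
    then obtain i where i: "p i \<noteq> i" by (auto simp: fun_eq_iff)
    moreover have inj: "inj p" using p by (auto intro: permutes_inj)
    ultimately have j: "p (p i) \<noteq> p i" by (auto dest: injD)
    have off: "c dvd A $ k $ p k" if "p k \<noteq> k" for k
      using A[of k "p k"] that by (simp add: mat_def)
    have "c * c dvd (\<Prod>k\<in>UNIV. A $ k $ p k)"
      by (rule dvd_prod_two[of _ i "p i"]) (use i j off in auto)
    then show "c * c dvd ?T p" by (rule dvd_mult)
  qed
  moreover have "det A = ?T id + (\<Sum>p\<in>?P - {id}. ?T p)"
    unfolding det_def by (rule sum.remove[OF fin]) (simp add: permutes_id)
  moreover have "?T id = (\<Prod>i\<in>UNIV. 1 + (A - mat 1) $ i $ i)"
    by (simp add: mat_def)
  moreover have "c * c dvd (\<Prod>i\<in>UNIV. 1 + (A - mat 1) $ i $ i) - 1 - (\<Sum>i\<in>UNIV. (A - mat 1) $ i $ i)"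
    by (rule dvd_prod_one_plus_minus_linear) (simp_all only: A finite)
  ultimately show ?thesis
    by (smt (verit, best) add_diff_eq diff_diff_eq dvd_add add.commute)
qed

text \<open>Units of \<open>K[T]\<close> are constants, so the first-order term of the determinant must vanish.\<close>

lemma coeff_det_unimodular:
  fixes A :: "'k::field poly ^ 'n ^ 'n"
  assumes n: "0 < n" and A: "\<And>i j. monom 1 n dvd (A - mat 1) $ i $ j"
    and unit: "det A dvd 1"
  shows "(\<Sum>i\<in>UNIV. coeff (A $ i $ i) n) = 0"
proof -
  have "monom 1 n * monom 1 n dvd det A - 1 - (\<Sum>i\<in>UNIV. (A - mat 1) $ i $ i)"
    by (rule det_minus_one_minus_trace_dvd[OF A])
  then obtain k where "det A - 1 - (\<Sum>i\<in>UNIV. (A - mat 1) $ i $ i) = monom 1 n * monom 1 n * k"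
    by (rule dvdE)
  also have "coeff \<dots> n = 0"
    using n by (simp add: mult_monom coeff_monom_mult)
  finally have "coeff (det A - 1 - (\<Sum>i\<in>UNIV. (A - mat 1) $ i $ i)) n = 0" .
  moreover have "coeff (det A) n = 0"
    using unit n by (auto simp: is_unit_poly_iff coeff_pCons split: nat.splits)
  ultimately show ?thesis
    using n by (simp add: coeff_sum mat_def of_nat_poly coeff_pCons sum_subtractf split: nat.splits)
qed

lemma det_dvd_one_of_mult_eq_mat_one:
  fixes A B :: "'a::comm_ring_1 ^ 'n ^ 'n"
  assumes "A ** B = mat 1"
  shows "det A dvd 1" "det B dvd 1"
proof -
  have "det A * det B = 1" using assms by (simp flip: det_mul)
  then show "det A dvd 1" "det B dvd 1" by (metis dvd_triv_left dvd_triv_right)+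
qed

section \<open>A cyclic three-dimensional representation\<close>

text \<open>
  The entries of the matrix of the word \<open>w\<close> in the representation of the free algebra on a
  three-dimensional space with basis indexed by \<^typ>\<open>gen\<close>, where \<open>x\<close>, \<open>y\<close>, \<open>z\<close> act as the matrix units
  \<open>E\<^sub>x\<^sub>y\<close>, \<open>E\<^sub>y\<^sub>z\<close>, \<open>E\<^sub>z\<^sub>x\<close>. Equivalently, \<open>w\<close> is read as a path in the cyclic quiver \<open>x \<rightarrow> y \<rightarrow> z \<rightarrow> x\<close>, each
  letter being the arrow that starts at the vertex of the same name.
\<close>

fun cyclic_path :: "gen list \<Rightarrow> gen \<Rightarrow> gen \<Rightarrow> 'k::field" where
  "cyclic_path [] u v = of_bool (u = v)"
| "cyclic_path (s # w) u v = (if s = u then cyclic_path w (rot u) v else 0)"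

lemma cyclic_path_append:
  "cyclic_path (w @ w') u v = (\<Sum>m\<in>UNIV. cyclic_path w u m * cyclic_path w' m v)"
proof (induction w arbitrary: u)
  case Nil
  show ?case by (cases u) (simp_all add: sum_gen)
qed simp

text \<open>
  The same representation over \<open>K[T]\<close>, with \<open>T E\<^sub>x\<^sub>y\<close>, \<open>T E\<^sub>y\<^sub>z\<close>, \<open>T E\<^sub>z\<^sub>x\<close> as the images of the
  generators; the power of \<open>T\<close> records the degree. Its trace distinguishes \<open>xyz\<close>, with trace \<open>T\<^sup>3\<close>,
  from \<open>xzy\<close>, with trace \<open>0\<close>.
\<close>

definition cyclic_rep :: "gen \<Rightarrow> gen \<Rightarrow> 'k::field free_alg \<Rightarrow> 'k poly" where
  "cyclic_rep u v = lin_ext (\<lambda>c. [:c:]) (\<lambda>w. monom (cyclic_path w u v) (length w))"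

lemma structure_map_pCons: "structure_map (\<lambda>c :: 'k::field. [:c:])"
  by (simp add: structure_map_def)

lemma cyclic_rep_add: "cyclic_rep u v (p + q) = cyclic_rep u v p + cyclic_rep u v q"
  unfolding cyclic_rep_def by (rule lin_ext_add[OF structure_map_pCons])

lemma cyclic_rep_single:
  "cyclic_rep u v (Poly_Mapping.single w c) = monom (c * cyclic_path w u v) (length w)"
  unfolding cyclic_rep_def by (simp add: lin_ext_single[OF structure_map_pCons] smult_monom)

lemma cyclic_rep_zero [simp]: "cyclic_rep u v 0 = 0"
  by (simp add: cyclic_rep_def)

lemma cyclic_rep_sum: "cyclic_rep u v (sum f A) = (\<Sum>a\<in>A. cyclic_rep u v (f a))"
  by (induction A rule: infinite_finite_induct) (simp_all add: cyclic_rep_add)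

lemma cyclic_rep_of_bool: "cyclic_rep u v (of_bool b) = of_bool (b \<and> u = v)"
  by (cases b) (auto simp: cyclic_rep_single zero_list_def monom_0 simp flip: single_one)

lemma cyclic_rep_mult:
  "cyclic_rep u v (p * q) = (\<Sum>m\<in>UNIV. cyclic_rep u m p * cyclic_rep m v q)"
proof (induction p rule: free_alg_induct)
  case zero
  show ?case by simp
next
  case (add w c p)
  have "cyclic_rep u v (Poly_Mapping.single w c * q) =
    (\<Sum>m\<in>UNIV. cyclic_rep u m (Poly_Mapping.single w c) * cyclic_rep m v q)"
  proof (induction q rule: free_alg_induct)
    case zero
    show ?case by simp
  next
    case (add w' d q)
    then show ?case
      by (simp add: distrib_left cyclic_rep_add cyclic_rep_single mult_single plus_list_def mult_monom
          sum.distrib cyclic_path_append sum_distrib_left monom_sum algebra_simps)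
  qed
  with add show ?case
    by (simp add: distrib_right cyclic_rep_add sum.distrib)
qed

lemma monom_dvd_cyclic_rep:
  assumes "order_ge n p"
  shows "monom 1 n dvd cyclic_rep u v p"
  unfolding cyclic_rep_def lin_ext_def
proof (rule dvd_sum)
  fix w assume "w \<in> Poly_Mapping.keys p"
  then have "n \<le> length w"
    using assms unfolding order_ge_def by (metis in_keys_iff not_le)
  then have "monom (cyclic_path w u v) (length w) =
      monom 1 n * (monom (cyclic_path w u v) (length w - n) :: 'a poly)"
    by (simp add: mult_monom)
  then show "monom 1 n dvd [:Poly_Mapping.lookup p w:] * monom (cyclic_path w u v) (length w)"
    by (metis dvd_mult dvd_triv_left)
qed

text \<open>
  Among the words of length \<open>3\<close>, only \<open>cyc u\<close> is a closed path based at \<open>u\<close>.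
\<close>

lemma coeff_cyclic_rep_cycle: "coeff (cyclic_rep u u p) 3 = Poly_Mapping.lookup p (cyc u)"
proof (induction p rule: free_alg_induct)
  case zero
  show ?case by simp
next
  case (add w c p)
  have "coeff (cyclic_rep u u (Poly_Mapping.single w c)) 3 = (if w = cyc u then c else 0)"
  \<comment> \<open>Words of another length land in another power of the indeterminate.\<close>
  proof (cases "length w = 3")
    case True
    then obtain a b d where "w = [a, b, d]"
      by (auto simp: numeral_3_eq_3 length_Suc_conv)
    then show ?thesis
      by (cases u) (auto simp: cyclic_rep_single cyc_def)
  next
    case False
    then show ?thesis by (auto simp: cyclic_rep_single cyc_def)
  qed
  with add show ?case
    by (simp add: cyclic_rep_add lookup_add lookup_single when_def)
qed

text \<open>
  In an index, the first component is the position of a \<open>3 \<times> 3\<close> block and the second is a vertex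
  of the quiver, that is, a position within the block.
\<close>

definition cyclic_block :: "(gen \<Rightarrow> gen \<Rightarrow> 'k::field free_alg) \<Rightarrow> 'k poly ^ (gen \<times> gen) ^ (gen \<times> gen)"
  where "cyclic_block P = (\<chi> a b. cyclic_rep (snd a) (snd b) (P (fst a) (fst b)))"

lemma cyclic_block_mult:
  "cyclic_block P ** cyclic_block Q = cyclic_block (\<lambda>i j. \<Sum>k\<in>UNIV. P i k * Q k j)"
  by (simp add: vec_eq_iff matrix_matrix_mult_def cyclic_block_def cyclic_rep_sum cyclic_rep_mult
      sum.cartesian_product case_prod_unfold)

lemma cyclic_block_one: "cyclic_block (\<lambda>i j. of_bool (i = j)) = mat 1"
  by (auto simp: vec_eq_iff cyclic_block_def cyclic_rep_of_bool mat_def prod_eq_iff)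

lemma cyclic_block_diff:
  fixes P Q :: "gen \<Rightarrow> gen \<Rightarrow> 'a::field free_alg"
  shows "cyclic_block P - cyclic_block Q = cyclic_block (\<lambda>i j. P i j - Q i j)"
proof -
  have "cyclic_rep u v (p - q) = cyclic_rep u v p - cyclic_rep u v q"
    for u v and p q :: "'a free_alg"
    by (metis add_diff_cancel diff_add_cancel cyclic_rep_add)
  then show ?thesis
    by (simp add: vec_eq_iff cyclic_block_def)
qed

section \<open>The trace obstruction\<close>

text \<open>
  The coefficient of \<open>T\<^sup>3\<close> in the determinant is the trace of the block matrix in degree \<open>3\<close>, and in
  that degree a diagonal entry picks out the coefficient of \<open>cyc u\<close>.
\<close>

lemma sum_cycles_eq_0_of_unit:
  assumes unit: "det (cyclic_block P) dvd 1"
    and ord: "\<And>i j. order_ge 3 (P i j - of_bool (i = j))"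
  shows "(\<Sum>s\<in>UNIV. \<Sum>u\<in>UNIV. Poly_Mapping.lookup (P s s) (cyc u)) = 0"
proof -
  have "cyclic_block P - mat 1 = cyclic_block (\<lambda>i j. P i j - of_bool (i = j))"
    using cyclic_block_diff[of P "\<lambda>i j. of_bool (i = j)"] by (simp add: cyclic_block_one)
  then have "monom 1 3 dvd (cyclic_block P - mat 1) $ i $ j" for i j
    by (simp add: cyclic_block_def monom_dvd_cyclic_rep ord)
  then have "(\<Sum>i\<in>UNIV. coeff (cyclic_block P $ i $ i) 3) = 0"
    by (intro coeff_det_unimodular unit) auto
  also have "(\<Sum>i\<in>UNIV. coeff (cyclic_block P $ i $ i) 3) =
    (\<Sum>s\<in>UNIV. \<Sum>u\<in>UNIV. Poly_Mapping.lookup (P s s) (cyc u))"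
    by (simp add: cyclic_block_def coeff_cyclic_rep_cycle sum.cartesian_product case_prod_unfold)
  finally show ?thesis .
qed

text \<open>
  Differentiating \<open>\<sigma> (\<sigma>\<^sup>-\<^sup>1 t) = t\<close> by the chain rule exhibits a one-sided inverse of the Jacobian
  matrix of \<open>\<sigma>\<close>, which suffices to make the determinant of its block matrix a unit. The left
  derivatives yield the first identity, the right ones the second. In the latter case the chain rule puts the Jacobian matrix on the
  right of the product and its rows are indexed by the components of \<open>\<sigma>\<close>.
\<close>

lemma automorphism_cycle_sums:
  fixes \<sigma> :: "'k::field free_alg \<Rightarrow> 'k free_alg"
  assumes aut: "alg_aut free_const \<sigma>"
    and ord: "\<And>s. order_ge 4 (\<sigma> (free_gen s) - free_gen s)"
  shows "(\<Sum>s\<in>UNIV. \<Sum>u\<in>UNIV. Poly_Mapping.lookup (\<sigma> (free_gen s)) (s # cyc u)) = 0"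
    and "(\<Sum>s\<in>UNIV. \<Sum>u\<in>UNIV. Poly_Mapping.lookup (\<sigma> (free_gen s)) (cyc u @ [s])) = 0"
proof -
  have endo: "alg_endo free_const \<sigma>" and bij: "bij \<sigma>"
    using aut by (auto simp: alg_aut_def)
  have aug: "Poly_Mapping.lookup (\<sigma> (free_gen t)) [] = 0" for t
    using ord[of t] by (simp add: order_ge_def lookup_minus lookup_free_gen_Nil)
  have inv: "\<sigma> (inv \<sigma> p) = p" for p
    using bij by (simp add: bij_is_surj surj_f_inv_f)
  have ord4: "order_ge (Suc 3) (\<sigma> (free_gen s) - free_gen s)" for s
    using ord[of s] by simp

  define P where "P s t = left_fox s (\<sigma> (free_gen t))" for s t
  define Q where "Q t i = \<sigma> (left_fox t (inv \<sigma> (free_gen i)))" for t i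
  have "(\<Sum>k\<in>UNIV. P i k * Q k j) = of_bool (i = j)" for i j
    unfolding P_def Q_def
    by (subst fox_chain_rule(1)[OF endo aug, symmetric]) (simp add: inv fox_gen)
  then have "cyclic_block P ** cyclic_block Q = mat 1"
    by (simp add: cyclic_block_mult cyclic_block_one)
  moreover have "P i j - of_bool (i = j) = left_fox i (\<sigma> (free_gen j) - free_gen j)" for i j
    by (simp add: P_def fox_diff fox_gen)
  ultimately have "(\<Sum>s\<in>UNIV. \<Sum>u\<in>UNIV. Poly_Mapping.lookup (P s s) (cyc u)) = 0"
    by (intro sum_cycles_eq_0_of_unit[of P]; simp only: order_ge_fox ord4)
      (blast intro: det_dvd_one_of_mult_eq_mat_one)+
  then show "(\<Sum>s\<in>UNIV. \<Sum>u\<in>UNIV. Poly_Mapping.lookup (\<sigma> (free_gen s)) (s # cyc u)) = 0"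
    by (simp add: P_def)

  define P' where "P' t s = right_fox s (\<sigma> (free_gen t))" for s t
  define Q' where "Q' i t = \<sigma> (right_fox t (inv \<sigma> (free_gen i)))" for t i
  have "(\<Sum>k\<in>UNIV. Q' i k * P' k j) = of_bool (i = j)" for i j
    unfolding P'_def Q'_def
    by (subst fox_chain_rule(2)[OF endo aug, symmetric]) (auto simp add: inv fox_gen)
  then have "cyclic_block Q' ** cyclic_block P' = mat 1"
    by (simp add: cyclic_block_mult cyclic_block_one)
  moreover have "P' i j - of_bool (i = j) = right_fox j (\<sigma> (free_gen i) - free_gen i)" for i j
    by (auto simp add: P'_def fox_diff fox_gen)
  ultimately have "(\<Sum>s\<in>UNIV. \<Sum>u\<in>UNIV. Poly_Mapping.lookup (P' s s) (cyc u)) = 0"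
    by (intro sum_cycles_eq_0_of_unit[of P']; simp only: order_ge_fox ord4)
      (blast intro: det_dvd_one_of_mult_eq_mat_one)+
  then show "(\<Sum>s\<in>UNIV. \<Sum>u\<in>UNIV. Poly_Mapping.lookup (\<sigma> (free_gen s)) (cyc u @ [s])) = 0"
    by (simp add: P'_def)
qed

section \<open>Homomorphisms determined by generators\<close>

lemma free_const_mult: "free_const c * Poly_Mapping.single w d = Poly_Mapping.single w (c * d)"
  by (simp add: free_const_def mult_single plus_list_def)

text \<open>The uniqueness half of the universal property of the free algebra.\<close>

lemma free_alg_hom_eq_free_eval:
  fixes f :: "'k::field free_alg \<Rightarrow> 'b::ring_1"
  assumes k: "structure_map \<kappa>"
    and one: "f 1 = 1" and const: "\<And>c. f (free_const c) = \<kappa> c"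
    and f_add: "\<And>p q. f (p + q) = f p + f q"
    and mult: "\<And>p q. f (p * q) = f p * f q"
  shows "f p = free_eval \<kappa> (\<lambda>s. f (free_gen s)) p"
proof -
  have zero: "f 0 = 0" using f_add[of 0 0] by simp
  have word: "f (Poly_Mapping.single w 1) = prod_list (map (\<lambda>s. f (free_gen s)) w)" for w
  proof (induction w)
    case Nil
    then show ?case using one by (simp add: free_const_one flip: free_const_def)
  next
    case (Cons s w)
    have "Poly_Mapping.single (s # w) (1 :: 'k) = free_gen s * Poly_Mapping.single w 1"
      by (simp add: free_gen_def mult_single plus_list_def)
    then show ?case by (simp add: mult Cons)
  qed
  show ?thesis
  proof (induction p rule: free_alg_induct)
    case zero
    then show ?case by (simp add: \<open>f 0 = 0\<close> free_eval_lin_ext)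
  next
    case (add w c p)
    have "f (Poly_Mapping.single w c) = f (free_const c * Poly_Mapping.single w 1)"
      by (simp add: free_const_mult)
    then show ?case
      using add by (simp add: f_add mult const word free_eval_lin_ext lin_ext_add[OF k] lin_ext_single[OF k])
  qed
qed

lemma metab_proj_hom:
  "metab_proj (p + q) = metab_proj p + metab_proj q"
  "metab_proj (p * q) = metab_proj p * metab_proj q"
  "metab_proj (p - q) = metab_proj p - metab_proj q"
  "metab_proj 1 = 1"
  "metab_proj (free_const c) = metab_const c"
  "metab_proj (free_gen s) = metab_gen s"
  by (simp_all add: plus_metab.abs_eq times_metab.abs_eq minus_metab.abs_eq one_metab_def
      metab_const.abs_eq metab_gen_def)

lemma metab_proj_eq_iff: "metab_proj p = metab_proj q \<longleftrightarrow> p - q \<in> metab_ideal"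
  by (simp add: metab.abs_eq_iff metab_rel_def)

lemma metab_proj_commutator:
  "metab_proj (commutator p q) = commutator (metab_proj p) (metab_proj q)"
  by (simp add: commutator_def metab_proj_hom)

lemma lift_agrees_of_generators:
  fixes \<sigma> :: "'k::field free_alg \<Rightarrow> 'k free_alg" and \<phi> :: "'k metab \<Rightarrow> 'k metab"
  assumes \<sigma>: "alg_endo free_const \<sigma>" and \<phi>: "alg_endo metab_const \<phi>"
    and gen: "\<And>s. metab_proj (\<sigma> (free_gen s)) = \<phi> (metab_gen s)"
  shows "metab_proj (\<sigma> p) = \<phi> (metab_proj p)"
proof -
  have "metab_proj (\<sigma> p) = free_eval metab_const (\<lambda>s. metab_proj (\<sigma> (free_gen s))) p"
    using \<sigma> by (intro free_alg_hom_eq_free_eval structure_map_metab_const)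
      (simp_all add: alg_endo_def metab_proj_hom)
  moreover have "\<phi> (metab_proj p) = free_eval metab_const (\<lambda>s. \<phi> (metab_proj (free_gen s))) p"
    using \<phi> by (intro free_alg_hom_eq_free_eval structure_map_metab_const)
      (simp_all add: alg_endo_def metab_proj_hom)
  ultimately show ?thesis by (simp add: gen metab_proj_hom)
qed

lemma alg_endo_id: "alg_endo \<kappa> id"
  by (simp add: alg_endo_def)

lemma alg_endo_comp: "alg_endo \<kappa> f \<Longrightarrow> alg_endo \<kappa> g \<Longrightarrow> alg_endo \<kappa> (f \<circ> g)"
  by (simp add: alg_endo_def)

lemma free_endo_eq_id:
  assumes f: "alg_endo free_const f" and "\<And>s. f (free_gen s) = free_gen s"
  shows "f = id"
proof
  fix p
  have "f p = free_eval free_const (\<lambda>s. f (free_gen s)) p"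
    "id p = free_eval free_const (\<lambda>s. id (free_gen s)) p"
    by (rule free_alg_hom_eq_free_eval[OF structure_map_free_const];
        use f in \<open>simp add: alg_endo_def\<close>)+
  then show "f p = id p" by (simp add: assms(2))
qed

lemma metab_endo_eq_id:
  fixes f :: "'k::field metab \<Rightarrow> 'k metab"
  assumes f: "alg_endo metab_const f" and "\<And>s. f (metab_gen s) = metab_gen s"
  shows "f = id"
proof
  fix p :: "'k metab"
  have "\<exists>q. p = metab_proj q"
    by (induction p rule: metab.abs_induct) blast
  then obtain q where "p = metab_proj q" ..
  then show "f p = id p"
    using lift_agrees_of_generators[OF alg_endo_id f, of q] assms(2)
    by (simp add: metab_proj_hom)
qed

lemma alg_endo_free_eval: "alg_endo free_const (free_eval free_const g)"
  using free_eval_one free_eval_add free_eval_mult free_eval_const structure_map_free_const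
  unfolding alg_endo_def by blast

lemma free_eval_cong:
  assumes "\<And>w s. w \<in> Poly_Mapping.keys p \<Longrightarrow> s \<in> set w \<Longrightarrow> g s = h s"
  shows "free_eval \<kappa> g p = free_eval \<kappa> h p"
  unfolding free_eval_def using assms by (intro sum.cong refl arg_cong2[where f = "(*)"]
      arg_cong[where f = prod_list] map_cong) auto

lemma free_eval_free_gen: "free_eval free_const free_gen = id"
  by (rule free_endo_eq_id[OF alg_endo_free_eval]) (simp add: free_eval_gen structure_map_free_const)

lemma alg_aut_inv:
  assumes "alg_aut \<kappa> \<sigma>"
  shows "alg_aut \<kappa> (inv \<sigma>)"
proof -
  have endo: "alg_endo \<kappa> \<sigma>" and bij: "bij \<sigma>" using assms by (auto simp: alg_aut_def)
  have eqI: "inv \<sigma> a = b" if "\<sigma> b = a" for a b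
    using bij that by (metis bij_inv_eq_iff)
  have "\<sigma> (inv \<sigma> a) = a" for a using bij by (metis bij_inv_eq_iff)
  then have "alg_endo \<kappa> (inv \<sigma>)"
    using endo unfolding alg_endo_def by (auto intro!: eqI)
  then show ?thesis using bij by (simp add: alg_aut_def bij_imp_bij_inv)
qed

section \<open>Tame automorphisms lift\<close>

text \<open>
  The polynomial added to \<open>\<alpha> t\<close> has a representative without \<open>t\<close>,
  and the resulting substitution is invertible already in the free algebra.
\<close>

lemma elementary_aut_liftable:
  fixes \<phi> :: "'k::field metab \<Rightarrow> 'k metab"
  assumes "elementary_aut \<phi>"
  shows "liftable \<phi>"
proof -
  note k = structure_map_free_const
  obtain t \<alpha> p where \<alpha>: "\<alpha> \<noteq> 0" and p: "\<forall>w\<in>Poly_Mapping.keys p. t \<notin> set w"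
    and \<phi>t: "\<phi> (metab_gen t) = metab_const \<alpha> * metab_gen t + metab_proj p"
    and \<phi>s: "\<And>s. s \<noteq> t \<Longrightarrow> \<phi> (metab_gen s) = metab_gen s"
    and \<phi>: "alg_endo metab_const \<phi>"
    using assms unfolding elementary_aut_def metab_without_def alg_aut_def by blast
  define \<sigma> where "\<sigma> = free_eval free_const (free_gen(t := free_const \<alpha> * free_gen t + p))"
  define \<rho> where "\<rho> = free_eval free_const (free_gen(t := free_const (1 / \<alpha>) * (free_gen t - p)))"
  \<comment> \<open>\<open>p\<close> does not involve \<open>t\<close>, so neither substitution changes it.\<close>
  have fix_p: "free_eval free_const (free_gen(t := q)) p = p" for q
    using free_eval_cong[of p "free_gen(t := q)" free_gen free_const] p
    by (fastforce simp: free_eval_free_gen)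
  have cancel: "free_const a * (free_const b * q) = q" if "a * b = 1" for a b :: 'k and q
    using structure_map_mult[OF k, of a b] that by (simp add: free_const_one flip: mult.assoc)
  have "\<sigma> (\<rho> (free_gen s)) = free_gen s" "\<rho> (\<sigma> (free_gen s)) = free_gen s" for s
    using \<alpha> by (cases "s = t"; simp add: \<sigma>_def \<rho>_def free_eval_gen[OF k] free_eval_mult[OF k]
        free_eval_add[OF k] free_eval_diff[OF k] free_eval_const[OF k] fix_p cancel)+
  then have "\<sigma> \<circ> \<rho> = id" "\<rho> \<circ> \<sigma> = id"
    by (auto intro!: free_endo_eq_id alg_endo_comp simp: \<sigma>_def \<rho>_def alg_endo_free_eval)
  then have "bij \<sigma>" by (intro o_bij)
  then have "alg_aut free_const \<sigma>"
    by (simp add: alg_aut_def \<sigma>_def alg_endo_free_eval)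
  moreover have "metab_proj (\<sigma> q) = \<phi> (metab_proj q)" for q
  proof (rule lift_agrees_of_generators[OF _ \<phi>])
    show "alg_endo free_const \<sigma>" by (simp add: \<sigma>_def alg_endo_free_eval)
    show "metab_proj (\<sigma> (free_gen s)) = \<phi> (metab_gen s)" for s
      by (cases "s = t") (simp_all add: \<sigma>_def free_eval_gen[OF k] metab_proj_hom \<phi>t \<phi>s)
  qed
  ultimately show ?thesis unfolding liftable_def by blast
qed

text \<open>
  Bijectivity is part of the induction because the inverse of a lift of \<open>\<phi>\<close> covers \<^term>\<open>inv \<phi>\<close> only
  if the latter is a genuine inverse.
\<close>

lemma tame_imp_liftable:
  assumes "tame \<phi>"
  shows "bij \<phi> \<and> liftable \<phi>"
  using assms
proof (induction rule: tame.induct)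
  case tame_id
  have "alg_aut free_const id" by (simp add: alg_aut_def alg_endo_id)
  then show ?case unfolding liftable_def by (metis bij_id id_apply)
next
  case (tame_elementary \<phi>)
  then show ?case by (simp add: elementary_aut_liftable elementary_aut_def alg_aut_def)
next
  case (tame_comp \<phi> \<psi>)
  then obtain \<sigma> \<rho> where "alg_aut free_const \<sigma>" "\<And>p. metab_proj (\<sigma> p) = \<phi> (metab_proj p)"
    "alg_aut free_const \<rho>" "\<And>p. metab_proj (\<rho> p) = \<psi> (metab_proj p)"
    unfolding liftable_def by blast
  moreover from this have "alg_aut free_const (\<sigma> \<circ> \<rho>)"
    by (auto simp: alg_aut_def alg_endo_comp bij_comp)
  ultimately have "liftable (\<phi> \<circ> \<psi>)"
    unfolding liftable_def by (intro exI[of _ "\<sigma> \<circ> \<rho>"]) simp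
  then show ?case using tame_comp.IH by (blast intro: bij_comp)
next
  case (tame_inv \<phi>)
  then obtain \<sigma> where \<sigma>: "alg_aut free_const \<sigma>" "\<And>p. metab_proj (\<sigma> p) = \<phi> (metab_proj p)"
    unfolding liftable_def by blast
  have "metab_proj (inv \<sigma> p) = inv \<phi> (metab_proj p)" for p
    using tame_inv.IH \<sigma> by (metis alg_aut_def bij_inv_eq_iff)
  then show ?case
    using alg_aut_inv[OF \<sigma>(1)] tame_inv.IH unfolding liftable_def by (blast intro: bij_imp_bij_inv)
qed

section \<open>A wild automorphism\<close>

text \<open>
  The inserted factor \<open>r\<close> does no harm: by the Leibniz rule for \<open>[_, d]\<close>, the product \<open>r [c, d]\<close> is a
  combination of commutators multiplied from the right only.
\<close>

lemma metab_comm_sandwich: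
  fixes a b c d r :: "'k::field metab"
  shows "commutator a b * r * commutator c d = 0"
proof -
  have "r * commutator c d = commutator (r * c) d - commutator r d * c"
    by (simp add: commutator_def algebra_simps)
  then have "commutator a b * (r * commutator c d) =
    commutator a b * commutator (r * c) d - commutator a b * commutator r d * c"
    by (simp add: right_diff_distrib mult.assoc)
  then show ?thesis by (simp add: metab_comm_mult mult.assoc)
qed

lemma alg_aut_shear:
  fixes x y z :: "'k::field metab"
  assumes xyz: "x = metab_gen X" "y = metab_gen Y" "z = metab_gen Z"
  shows "alg_aut metab_const (metab_endo (x + x ^ 2 * commutator y z) y z)"
proof -
  let ?k = "commutator y z"
  \<comment> \<open>\<open>x\<^sup>2[y, z]\<close> does not change when \<open>x\<close> is moved by a left multiple of \<open>[y, z]\<close>; hence the inverse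
    is obtained by reversing the sign of the added term.\<close>
  have sq: "(x + e * ?k)\<^sup>2 * ?k = x\<^sup>2 * ?k" for e
    using metab_comm_sandwich[of y z x y z] metab_comm_sandwich[of y z e y z]
      metab_comm_mult[of y z y z]
    by (simp add: power2_eq_square algebra_simps)
  have neg: "x - x\<^sup>2 * ?k = x + (- x\<^sup>2) * ?k" by simp
  let ?f = "metab_endo (x + x\<^sup>2 * ?k) y z" and ?g = "metab_endo (x - x\<^sup>2 * ?k) y z"
  have ev: "\<phi> (x + x\<^sup>2 * ?k) = \<phi> x + (\<phi> x)\<^sup>2 * commutator (\<phi> y) (\<phi> z)"
    "\<phi> (x - x\<^sup>2 * ?k) = \<phi> x - (\<phi> x)\<^sup>2 * commutator (\<phi> y) (\<phi> z)"
    if "alg_endo metab_const \<phi>" for \<phi>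
  proof -
    have hom: "\<phi> (a + b) = \<phi> a + \<phi> b" "\<phi> (a * b) = \<phi> a * \<phi> b" for a b
      using that by (auto simp: alg_endo_def)
    have diff: "\<phi> (a - b) = \<phi> a - \<phi> b" for a b
      by (metis add_diff_cancel diff_add_cancel hom(1))
    show "\<phi> (x + x\<^sup>2 * ?k) = \<phi> x + (\<phi> x)\<^sup>2 * commutator (\<phi> y) (\<phi> z)"
      "\<phi> (x - x\<^sup>2 * ?k) = \<phi> x - (\<phi> x)\<^sup>2 * commutator (\<phi> y) (\<phi> z)"
      by (simp_all add: hom diff commutator_def power2_eq_square)
  qed
  have "?f (?g (metab_gen s)) = metab_gen s" "?g (?f (metab_gen s)) = metab_gen s" for s
    using sq[of "x\<^sup>2"] sq[of "- x\<^sup>2"] unfolding neg[symmetric]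
    by (cases s; simp add: ev alg_endo_metab_endo flip: xyz; simp add: xyz)+
  then have "?f \<circ> ?g = id" "?g \<circ> ?f = id"
    by (auto intro!: metab_endo_eq_id alg_endo_comp alg_endo_metab_endo)
  then show ?thesis by (simp add: alg_aut_def alg_endo_metab_endo o_bij)
qed

text \<open>
  A lift is the identity in degrees below \<open>4\<close>, so both cycle sums of its components vanish. Elements
  of the ideal contribute equally to the two sums, whereas \<open>x\<^sup>2[y, z]\<close> contributes to the first only.
\<close>

lemma shear_not_liftable:
  fixes x y z :: "'k::field metab"
  assumes xyz: "x = metab_gen X" "y = metab_gen Y" "z = metab_gen Z"
  shows "\<not> liftable (metab_endo (x + x ^ 2 * commutator y z) y z)"
proof
  assume "liftable (metab_endo (x + x ^ 2 * commutator y z) y z)"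
  then obtain \<sigma> where aut: "alg_aut free_const \<sigma>" and
    lift: "\<And>p. metab_proj (\<sigma> p) = metab_endo (x + x ^ 2 * commutator y z) y z (metab_proj p)"
    unfolding liftable_def by blast
  define F :: "'k free_alg" where
    "F = Poly_Mapping.single [X, X, Y, Z] 1 - Poly_Mapping.single [X, X, Z, Y] 1"
  have F: "F = (free_gen X)\<^sup>2 * commutator (free_gen Y) (free_gen Z)"
    by (simp add: F_def commutator_def free_gen_def power2_eq_square mult_single plus_list_def
        right_diff_distrib)
  \<comment> \<open>The part of \<open>\<sigma>\<close> which its action on the metabelian quotient leaves undetermined.\<close>
  define r where "r s = \<sigma> (free_gen s) - (free_gen s + (if s = X then F else 0))" for s
  have "metab_proj (\<sigma> (free_gen s)) = metab_proj (free_gen s + (if s = X then F else 0))" for s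
    by (cases s) (simp_all add: lift metab_proj_hom F power2_eq_square metab_proj_commutator xyz)
  then have r: "order_ge 4 (r s)"
    "(\<Sum>u\<in>UNIV. Poly_Mapping.lookup (r s) (s # cyc u)) =
     (\<Sum>u\<in>UNIV. Poly_Mapping.lookup (r s) (cyc u @ [s]))" for s
    using metab_ideal_order_and_traces[of "r s"] by (simp_all add: r_def metab_proj_eq_iff)
  have \<sigma>: "\<sigma> (free_gen s) = free_gen s + (if s = X then F else 0) + r s" for s
    by (simp add: r_def)
  have "order_ge 4 (\<sigma> (free_gen s) - free_gen s)" for s
    using r(1)[of s] by (auto simp: \<sigma> order_ge_def lookup_add lookup_minus F_def lookup_single when_def)
  from automorphism_cycle_sums[OF aut this]
  have "(\<Sum>s\<in>UNIV. \<Sum>u\<in>UNIV. Poly_Mapping.lookup (\<sigma> (free_gen s)) (s # cyc u)) =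
    (\<Sum>s\<in>UNIV. \<Sum>u\<in>UNIV. Poly_Mapping.lookup (\<sigma> (free_gen s)) (cyc u @ [s]))"
    by simp
  \<comment> \<open>The terms \<open>r s\<close> cancel and the generators have degree \<open>1\<close>. On the left, \<open>xxyz\<close> is the only word
    of \<open>F\<close> that is counted; on the right, there is none.\<close>
  then have "(\<Sum>u\<in>UNIV. Poly_Mapping.lookup F (X # cyc u)) =
    (\<Sum>u\<in>UNIV. Poly_Mapping.lookup F (cyc u @ [X]))"
    unfolding \<sigma> lookup_add sum.distrib r(2)
    by (simp add: sum_gen free_gen_def lookup_single cyc_def)
  then show False
    by (simp add: sum_gen F_def cyc_def lookup_minus lookup_single)
qed

lemma pd_metab_gen: "pd_metab s (metab_gen t) = (of_bool (s = t) :: 'k::field cpoly)"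
  by (simp add: metab_gen_def pd_metab.abs_eq free_gen_def pd_free_lin_ext lin_ext_single
      structure_map_cpoly_const structure_map_one pd_word_Cons pd_word_Nil)

theorem theorem3p2:
  fixes x y z :: "'k::field metab"
    and x1 y1 z1 y2 z2 :: "'k cpoly"
    and \<tau> :: "'k metab \<Rightarrow> 'k metab"
  assumes "x = metab_gen X" and "y = metab_gen Y" and "z = metab_gen Z"
    and "x1 = cvar (Var1 X)" and "y1 = cvar (Var1 Y)" and "z1 = cvar (Var1 Z)"
    and "y2 = cvar (Var2 Y)" and "z2 = cvar (Var2 Z)"
    and "\<tau> = metab_endo (x + x ^ 2 * commutator y z) y z"
  shows "wild \<tau> \<and> \<not> liftable \<tau> \<and>
    jacobian_metab \<tau> =
      vector [vector [1, 0, 0],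
              vector [x1 ^ 2 * (z2 - z1), 1, 0],
              vector [x1 ^ 2 * (y1 - y2), 0, 1]] \<and>
    (\<exists>A B. elementary_matrix A \<and> elementary_matrix B \<and> jacobian_metab \<tau> = A ** B)"
proof (intro conjI)
  note xyz = assms(1-3)
  have not_liftable: "\<not> liftable \<tau>"
    unfolding assms(9) by (rule shear_not_liftable[OF xyz])
  then show "\<not> liftable \<tau>" .
  show "wild \<tau>"
    using alg_aut_shear[OF xyz] tame_imp_liftable[of \<tau>] not_liftable
    by (auto simp: wild_def assms(9))
  have expand: "x + x\<^sup>2 * commutator y z = metab_proj (Poly_Mapping.single [X] 1 +
     (Poly_Mapping.single [X, X, Y, Z] 1 - Poly_Mapping.single [X, X, Z, Y] 1))"
    by (simp add: assms(1-3) power2_eq_square commutator_def mult_single plus_list_def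
        right_diff_distrib free_gen_def flip: metab_proj_hom)
  have pd: "pd_metab s (x + x\<^sup>2 * commutator y z) =
      pd_word s [X] + (pd_word s [X, X, Y, Z] - pd_word s [X, X, Z, Y])" for s
    unfolding expand
    by (simp add: pd_metab.abs_eq pd_free_add pd_free_diff)
       (simp add: pd_free_lin_ext lin_ext_single structure_map_cpoly_const structure_map_one)
  have "pd_metab X (x + x\<^sup>2 * commutator y z) = 1"
    "pd_metab Y (x + x\<^sup>2 * commutator y z) = x1\<^sup>2 * (z2 - z1)"
    "pd_metab Z (x + x\<^sup>2 * commutator y z) = x1\<^sup>2 * (y1 - y2)"
    unfolding pd by (simp_all add: pd_word_Cons pd_word_Nil assms(4-8) power2_eq_square algebra_simps)
  then show jac: "jacobian_metab \<tau> =
      vector [vector [1, 0, 0],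
              vector [x1 ^ 2 * (z2 - z1), 1, 0],
              vector [x1 ^ 2 * (y1 - y2), 0, 1]]"
    by (simp add: jacobian_metab_def assms(2,3,9) pd_metab_gen)
  let ?A = "vector [vector [1, 0, 0], vector [x1 ^ 2 * (z2 - z1), 1, 0], vector [0, 0, 1]]
    :: 'k cpoly ^ 3 ^ 3"
  let ?B = "vector [vector [1, 0, 0], vector [0, 1, 0], vector [x1 ^ 2 * (y1 - y2), 0, 1]]
    :: 'k cpoly ^ 3 ^ 3"
  have "elementary_matrix ?A"
    unfolding elementary_matrix_def
    by (intro exI[of _ 2] exI[of _ 1]) (simp add: forall_3 mat_def)
  moreover have "elementary_matrix ?B"
    unfolding elementary_matrix_def
    by (intro exI[of _ 3] exI[of _ 1]) (simp add: forall_3 mat_def)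
  moreover have "jacobian_metab \<tau> = ?A ** ?B"
    unfolding jac by (simp add: vec_eq_iff forall_3 matrix_matrix_mult_def sum_3)
  ultimately show "\<exists>A B. elementary_matrix A \<and> elementary_matrix B \<and> jacobian_metab \<tau> = A ** B"
    by blast
qed

end
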